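(* Let $n\ge 1$ be an integer. There exist exactly $8n+4$ simple permutations $\theta\in S_{4n+2}$ of mixed order $4n+2$ such that $\theta^{2}$ is one of the following permutations (right Pastings): (1) $\alpha_{2n+1}\diamond\mid\alpha_{2n+1}$; (2) $\beta_{2n+1}\diamond\mid\beta_{2n+1}$; (3) $\alpha_{2n+1}\diamond\mid\beta_{2n+1}$; (4) $\beta_{2n+1}\diamond\mid\alpha_{2n+1}$.
   Context: $S_N$ denotes the group of permutations of $\{1,\dots,N\}$; its elements are called permutations of order $N$. Simple permutations of odd order. For $n\ge 1$, the simple permutations of odd order $2n+1$ are the two permutations $\alpha_{2n+1},\beta_{2n+1}\in S_{2n+1}$ defined by: - $\alpha_{2n+1}(i)=2n+2-i$ for $1\le i\le n$; $\alpha_{2n+1}(i)=2n+1-i$ for $n+1\le i\le 2n$; $\alpha_{2n+1}(2n+1)=n+1$. - $\beta_{2n+1}(1)=n+1$; $\beta_{2n+1}(i)=2n+3-i$ for $2\le i\le n+1$; $\beta_{2n+1}(i)=2n+2-i$ for $n+2\le i\le 2n+1$. (For example, in one-line notation, $\alpha_3=(3\,1\,2)$, $\beta_3=(2\,3\,1)$, $\alpha_5=(5\,4\,2\,1\,3)$, $\beta_5=(3\,5\,4\,2\,1)$.) Blocks. $P(4n+2,2,1)=\{1,\dots,2n+1\}$ and $P(4n+2,2,2)=\{2n+2,\dots,4n+2\}$. Simple permutations of mixed order $4n+2$. A permutation $\theta\in S_{4n+2}$ is simple (of mixed order $4n+2$) if (a) $\theta[P(4n+2,2,j)]=P(4n+2,2,\phi(j))$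 for $j=1,2$, where $\phi$ is the transposition exchanging $1$ and $2$; and (b) for each $j\in\{1,2\}$, the restriction of $\theta^2$ to $P(4n+2,2,j)$ is a simple permutation of odd order $2n+1$, i.e., after identifying $P(4n+2,2,j)$ with $\{1,\dots,2n+1\}$ by the order-preserving bijection, it equals $\alpha_{2n+1}$ or $\beta_{2n+1}$. Right Pasting. For $\alpha\in S_m$, $\beta\in S_k$, the permutation $\alpha\diamond\mid\beta\in S_{m+k}$ is defined by $(\alpha\diamond\mid\beta)(i)=\alpha(i)$ for $1\le i\le m$ and $(\alpha\diamond\mid\beta)(m+i)=\beta(i)+m$ for $1\le i\le k$. *)

theory Defs
  imports "HOL-Combinatorics.Permutations"
begin

text \<open>
  Elements of \<open>S_N\<close> are functions \<open>p :: nat \<Rightarrow> nat\<close> with \<open>p permutes {1..N}\<close>; in particular they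
  fix every number outside \<open>{1..N}\<close>, so that equality of functions is equality in \<open>S_N\<close>.
  All truncated subtractions below have a nonnegative result in the guarded range.
\<close>

definition alpha_odd :: "nat \<Rightarrow> nat \<Rightarrow> nat" where
  "alpha_odd n i =
     (if 1 \<le> i \<and> i \<le> n then 2 * n + 2 - i
      else if n + 1 \<le> i \<and> i \<le> 2 * n then 2 * n + 1 - i
      else if i = 2 * n + 1 then n + 1
      else i)"

definition beta_odd :: "nat \<Rightarrow> nat \<Rightarrow> nat" where
  "beta_odd n i =
     (if i = 1 then n + 1
      else if 2 \<le> i \<and> i \<le> n + 1 then 2 * n + 3 - i
      else if n + 2 \<le> i \<and> i \<le> 2 * n + 1 then 2 * n + 2 - i
      else i)"

definition simple_odd :: "nat \<Rightarrow> (nat \<Rightarrow> nat) \<Rightarrow> bool" where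
  "simple_odd n \<sigma> \<longleftrightarrow> \<sigma> = alpha_odd n \<or> \<sigma> = beta_odd n"

text \<open>\<open>block n j\<close> is \<open>P(4n+2, 2, j)\<close>; it is only used for \<open>j \<in> {1, 2}\<close>.\<close>

definition block :: "nat \<Rightarrow> nat \<Rightarrow> nat set" where
  "block n j = (if j = 1 then {1..2 * n + 1} else {2 * n + 2..4 * n + 2})"

text \<open>In the second condition \<open>h\<close> is the (unique) order-preserving bijection identifying
  \<open>{1..2n+1}\<close> with the block.\<close>

definition simple_mixed :: "nat \<Rightarrow> (nat \<Rightarrow> nat) \<Rightarrow> bool" where
  "simple_mixed n \<theta> \<longleftrightarrow>
     \<theta> permutes {1..4 * n + 2} \<and>
     (\<forall>j\<in>{1, 2}. \<theta> ` block n j = block n (transpose 1 2 j)) \<and>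
     (\<forall>j\<in>{1, 2}. \<exists>h \<sigma>.
        bij_betw h {1..2 * n + 1} (block n j) \<and> strict_mono_on {1..2 * n + 1} h \<and>
        simple_odd n \<sigma> \<and> (\<forall>i\<in>{1..2 * n + 1}. (\<theta> ^^ 2) (h i) = h (\<sigma> i)))"

text \<open>\<open>m\<close> and \<open>k\<close> are the orders of \<open>\<alpha>\<close> and \<open>\<beta>\<close>, which the functions do not carry.\<close>

definition right_pasting ::
    "nat \<Rightarrow> nat \<Rightarrow> (nat \<Rightarrow> nat) \<Rightarrow> (nat \<Rightarrow> nat) \<Rightarrow> nat \<Rightarrow> nat" where
  "right_pasting m k \<alpha> \<beta> i =
     (if 1 \<le> i \<and> i \<le> m then \<alpha> i
      else if m + 1 \<le> i \<and> i \<le> m + k then \<beta> (i - m) + m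
      else i)"

end

theory Submission
  imports Defs "HOL-Combinatorics.Orbits"
begin

text \<open>
  Let \<open>\<pi>\<close> be one of the four right Pastings. It acts as a single cycle on each of the two blocks,
  because \<open>alpha_odd n\<close> is a cycle of length \<open>2n+1\<close> (\<open>cyclic_on_alpha_odd\<close>) and \<open>beta_odd n\<close> is its
  conjugate by the reversal of \<open>{1..2n+1}\<close> (\<open>cyclic_on_beta_odd\<close>). So the question is how many
  square roots of \<open>\<pi>\<close> exchange two \<open>\<pi>\<close>-cycles \<open>A\<close> and \<open>B\<close> of the same length.

  Such a root \<open>\<theta>\<close> commutes with \<open>\<pi> = \<theta> \<circ> \<theta>\<close>. Fix \<open>a \<in> A\<close>. The value \<open>\<theta> a \<in> B\<close> determines \<open>\<theta>\<close> along
  the whole cycle \<open>A\<close>, by \<open>\<theta> (\<pi>\<^sup>k a) = \<pi>\<^sup>k (\<theta> a)\<close>, and then also on \<open>B\<close>, by \<open>\<theta> (\<theta> x) = \<pi> x\<close>.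
  Conversely, since both cycles have the same length, every \<open>b \<in> B\<close> is the image of \<open>a\<close> under a
  bijection \<open>f\<close> from \<open>A\<close> to \<open>B\<close> that commutes with \<open>\<pi>\<close> (\<open>cyclic_on_conjugation\<close>), and \<open>f\<close> on \<open>A\<close>
  together with \<open>\<pi> \<circ> f\<inverse>\<close> on \<open>B\<close> is a root. Hence there are exactly \<open>card A = 2n+1\<close> roots
  (\<open>card_exchanging_roots\<close>).

  A Pasting restricts to simple permutations of odd order on the blocks, so the simple permutations
  of mixed order with square \<open>\<pi>\<close> are exactly the square roots of \<open>\<pi>\<close> that exchange the blocks
  (\<open>simple_mixed_with_square_eq_exchanging_roots\<close>). For \<open>n \<ge> 1\<close> the four Pastings are distinct, which gives
  \<open>4 (2n+1) = 8n+4\<close> permutations.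
\<close>

section \<open>Conjugating one cycle to another\<close>

lemma cyclic_on_funpow_period:
  assumes "cyclic_on g A" "a \<in> A"
  shows "(g ^^ card A) a = a"
    and "bij_betw (\<lambda>k. (g ^^ k) a) {0..<card A} A"
proof -
  have orb: "A = orbit g a" using orbit_cyclic_eq3[OF assms] by simp
  then have self: "a \<in> orbit g a" using assms(2) by simp
  define p where "p = funpow_dist1 g a a"
  have inj: "inj_on (\<lambda>k. (g ^^ k) a) {0..<p}"
    unfolding p_def by (rule inj_on_funpow_dist1[OF self])
  have im: "A = (\<lambda>k. (g ^^ k) a) ` {0..<p}"
    unfolding orb p_def by (rule orbit_conv_funpow_dist1[OF self])
  have p: "card A = p" using card_image[OF inj] im by simp
  show "(g ^^ card A) a = a"
    unfolding p unfolding p_def by (rule funpow_dist1_prop[OF self])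
  show "bij_betw (\<lambda>k. (g ^^ k) a) {0..<card A} A"
    unfolding p bij_betw_def using inj im by simp
qed

text \<open>
  The conjugating map is forced to send \<open>g\<^sup>k a\<close> to \<open>h\<^sup>k b\<close>; this is well defined because both
  sides have period \<open>card A = card B\<close> in \<open>k\<close>.
\<close>

lemma cyclic_on_conjugation:
  assumes g: "cyclic_on g A" and h: "cyclic_on h B" and card: "card A = card B"
    and a: "a \<in> A" and b: "b \<in> B"
  obtains f where "bij_betw f A B" "f a = b" "\<And>x. x \<in> A \<Longrightarrow> f (g x) = h (f x)"
proof -
  let ?I = "{0..<card A}"
  let ?e = "\<lambda>k. (g ^^ k) a" and ?e' = "\<lambda>k. (h ^^ k) b"
  note gA = cyclic_on_funpow_period[OF g a] and hB = cyclic_on_funpow_period[OF h b]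
  define f where "f = ?e' \<circ> inv_into ?I ?e"
  have "bij_betw f A B"
    unfolding f_def using gA(2) hB(2) card
    by (metis bij_betw_inv_into bij_betw_trans)
  have pos: "card A > 0"
    using a finite_cyclic_on[OF g] card_gt_0_iff by blast
  have f_pow: "f (?e k) = ?e' k" for k
  proof -
    have "?e k = ?e (k mod card A)" "?e' k = ?e' (k mod card A)"
      using funpow_mod_eq[OF gA(1)] funpow_mod_eq[OF hB(1)] card by simp_all
    moreover have "inv_into ?I ?e (?e (k mod card A)) = k mod card A"
      using gA(2) pos by (intro inv_into_f_f) (auto simp: bij_betw_def)
    ultimately show ?thesis by (simp add: f_def)
  qed
  have "f (g x) = h (f x)" if x: "x \<in> A" for x
  proof -
    obtain k where "x = ?e k" using gA(2) x by (auto simp: bij_betw_def)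
    then show ?thesis using f_pow[of k] f_pow[of "Suc k"] by simp
  qed
  moreover have "f a = b" using f_pow[of 0] by simp
  ultimately show thesis using that \<open>bij_betw f A B\<close> by blast
qed

section \<open>Square roots exchanging two cycles\<close>

definition exchanging_roots :: "('a \<Rightarrow> 'a) \<Rightarrow> 'a set \<Rightarrow> 'a set \<Rightarrow> ('a \<Rightarrow> 'a) set" where
  "exchanging_roots \<pi> A B =
     {\<theta>. \<theta> permutes A \<union> B \<and> \<theta> ` A = B \<and> \<theta> ` B = A \<and> \<theta> \<circ> \<theta> = \<pi>}"

text \<open>A root commutes with \<open>\<pi>\<close>, so its value at \<open>a\<close> propagates along the cycle of \<open>a\<close>.\<close>

lemma inj_on_exchanging_roots:
  assumes A: "cyclic_on \<pi> A" and a: "a \<in> A"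
  shows "inj_on (\<lambda>\<theta>. \<theta> a) (exchanging_roots \<pi> A B)"
proof (rule inj_onI, rule ext)
  fix \<theta> \<theta>' x
  assume \<theta>: "\<theta> \<in> exchanging_roots \<pi> A B" and \<theta>': "\<theta>' \<in> exchanging_roots \<pi> A B"
    and eq: "\<theta> a = \<theta>' a"
  have sq: "\<theta> (\<theta> y) = \<pi> y" "\<theta>' (\<theta>' y) = \<pi> y" for y
    using \<theta> \<theta>' by (auto simp: exchanging_roots_def fun_eq_iff)
  have comm: "\<theta> (\<pi> y) = \<pi> (\<theta> y)" "\<theta>' (\<pi> y) = \<pi> (\<theta>' y)" for y
    using sq by metis+
  have onA: "\<theta> y = \<theta>' y" if "y \<in> A" for y
  proof -
    have "y \<in> orbit \<pi> a" using orbit_cyclic_eq3[OF A a] that by simp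
    then show ?thesis by induction (simp_all add: comm eq)
  qed
  consider "x \<in> A" | "x \<in> B" | "x \<notin> A \<union> B" by blast
  then show "\<theta> x = \<theta>' x"
  proof cases
    case 1
    then show ?thesis by (rule onA)
  next
    case 2
    then obtain y where y: "y \<in> A" "x = \<theta> y" using \<theta> by (auto simp: exchanging_roots_def)
    then show ?thesis using sq onA by metis
  next
    case 3
    then show ?thesis using \<theta> \<theta>' by (simp add: exchanging_roots_def permutes_def)
  qed
qed

text \<open>
  A bijection \<open>f\<close> from \<open>A\<close> to \<open>B\<close> that commutes with \<open>\<pi>\<close> extends to a root by taking
  \<open>\<pi> \<circ> f\<inverse>\<close> on \<open>B\<close>: the composite is \<open>\<pi> \<circ> f\<inverse> \<circ> f\<close> on \<open>A\<close> and \<open>f \<circ> \<pi> \<circ> f\<inverse>\<close> on \<open>B\<close>, both equal to \<open>\<pi>\<close>.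
\<close>

lemma exchanging_root_exists:
  assumes A: "cyclic_on \<pi> A" and B: "cyclic_on \<pi> B"
    and disj: "A \<inter> B = {}" and card: "card A = card B"
    and fix_outside: "\<And>x. x \<notin> A \<union> B \<Longrightarrow> \<pi> x = x"
    and a: "a \<in> A" and b: "b \<in> B"
  obtains \<theta> where "\<theta> \<in> exchanging_roots \<pi> A B" "\<theta> a = b"
proof -
  obtain f where f: "bij_betw f A B" "f a = b"
    and comm: "\<And>x. x \<in> A \<Longrightarrow> f (\<pi> x) = \<pi> (f x)"
    using cyclic_on_conjugation[OF A B card a b] by blast
  define f' where "f' = inv_into A f"
  have f': "bij_betw f' B A" "\<And>x. x \<in> A \<Longrightarrow> f' (f x) = x" "\<And>y. y \<in> B \<Longrightarrow> f (f' y) = y"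
    using f(1) bij_betw_inv_into[OF f(1)] unfolding f'_def
    by (auto simp: bij_betw_inv_into_left bij_betw_inv_into_right)
  have fin: "finite A" "finite B" using A B finite_cyclic_on by auto
  have fA: "f x \<in> B" if "x \<in> A" for x using f(1) that by (auto simp: bij_betw_def)
  have f'B: "f' y \<in> A" if "y \<in> B" for y using f'(1) that by (auto simp: bij_betw_def)
  have \<pi>A: "\<pi> x \<in> A" if "x \<in> A" for x using cyclic_on_inI[OF A that] .
  have \<pi>_im: "\<pi> ` A = A"
  proof
    show "\<pi> ` A \<subseteq> A" using \<pi>A by blast
    show "A \<subseteq> \<pi> ` A"
    proof
      fix y assume "y \<in> A"
      then have "y \<in> orbit \<pi> a" using orbit_cyclic_eq3[OF A a] by simp
      then show "y \<in> \<pi> ` A"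
      proof cases
        case (step z)
        then show ?thesis using orbit_cyclic_eq3[OF A a] by blast
      qed (use a in blast)
    qed
  qed
  define \<theta> where "\<theta> x = (if x \<in> A then f x else if x \<in> B then \<pi> (f' x) else x)" for x
  have onA: "\<theta> x = f x" if "x \<in> A" for x using that by (simp add: \<theta>_def)
  have onB: "\<theta> x = \<pi> (f' x)" if "x \<in> B" for x using that disj by (auto simp: \<theta>_def)
  have off: "\<theta> x = x" if "x \<notin> A \<union> B" for x using that by (simp add: \<theta>_def)
  have imA: "\<theta> ` A = B" using f(1) onA by (auto simp: bij_betw_def)
  have "\<theta> ` B = \<pi> ` f' ` B" using onB by (auto simp: image_image)
  then have imB: "\<theta> ` B = A" using f'(1) \<pi>_im by (simp add: bij_betw_def)
  have surj: "\<theta> ` (A \<union> B) = A \<union> B" using imA imB by (auto simp: image_Un)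
  have "bij_betw \<theta> (A \<union> B) (A \<union> B)"
    unfolding bij_betw_def using surj fin by (metis eq_card_imp_inj_on finite_UnI)
  then have perm: "\<theta> permutes A \<union> B" using off by (intro bij_imp_permutes)
  have "\<theta> (\<theta> x) = \<pi> x" for x
  proof -
    consider "x \<in> A" | "x \<in> B" | "x \<notin> A \<union> B" by blast
    then show ?thesis
    proof cases
      case 1
      then show ?thesis using fA onA onB f'(2) by simp
    next
      case 2
      then have "\<theta> (\<theta> x) = f (\<pi> (f' x))" using f'B \<pi>A onA onB by simp
      also have "\<dots> = \<pi> x" using comm f'B f'(3) 2 by simp
      finally show ?thesis .
    next
      case 3
      then show ?thesis using off fix_outside by simp
    qed
  qed
  then have "\<theta> \<circ> \<theta> = \<pi>" by auto
  then have "\<theta> \<in> exchanging_roots \<pi> A B"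
    using perm imA imB by (simp add: exchanging_roots_def)
  moreover have "\<theta> a = b" using onA a f(2) by simp
  ultimately show thesis by (rule that)
qed

text \<open>For a fixed \<open>a \<in> A\<close>, evaluation at \<open>a\<close> is a bijection from the roots to \<open>B\<close>.\<close>

lemma card_exchanging_roots:
  assumes A: "cyclic_on \<pi> A" and B: "cyclic_on \<pi> B"
    and disj: "A \<inter> B = {}" and card: "card A = card B"
    and fix_outside: "\<And>x. x \<notin> A \<union> B \<Longrightarrow> \<pi> x = x"
  shows "card (exchanging_roots \<pi> A B) = card A"
proof -
  obtain a where a: "a \<in> A" using A by (auto simp: cyclic_on_def)
  have "(\<lambda>\<theta>. \<theta> a) ` exchanging_roots \<pi> A B = B"
  proof
    show "(\<lambda>\<theta>. \<theta> a) ` exchanging_roots \<pi> A B \<subseteq> B"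
      using a by (auto simp: exchanging_roots_def)
    show "B \<subseteq> (\<lambda>\<theta>. \<theta> a) ` exchanging_roots \<pi> A B"
    proof
      fix b assume "b \<in> B"
      then obtain \<theta> where "\<theta> \<in> exchanging_roots \<pi> A B" "\<theta> a = b"
        using exchanging_root_exists[OF A B disj card fix_outside a] by blast
      then show "b \<in> (\<lambda>\<theta>. \<theta> a) ` exchanging_roots \<pi> A B" by blast
    qed
  qed
  then show ?thesis
    using card_image[OF inj_on_exchanging_roots[OF A a]] card by metis
qed

section \<open>The simple permutations of odd order are cycles\<close>

text \<open>
  Starting from the middle, \<open>alpha_odd n\<close> spirals outwards: it visits
  \<open>n+1, n, n+2, n-1, n+3, \<dots>, 1, 2n+1\<close> and then returns to \<open>n+1\<close>.
\<close>

lemma cyclic_on_alpha_odd: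
  assumes n: "n \<ge> 1"
  shows "cyclic_on (alpha_odd n) {1..2 * n + 1}"
proof -
  let ?O = "orbit (alpha_odd n) (n + 1)"
  \<comment> \<open>The \<open>k\<close>-th turn of the spiral visits \<open>n-k\<close> and then \<open>n+2+k\<close>.\<close>
  have steps: "n - k \<in> ?O \<and> n + 2 + k \<in> ?O" if "k < n" for k
    using that
  proof (induction k)
    case 0
    have "alpha_odd n (n + 1) = n" using n by (simp add: alpha_odd_def)
    then have "n \<in> ?O" using orbit.base[of "alpha_odd n" "n + 1"] by simp
    moreover have "alpha_odd n n = n + 2" using n by (simp add: alpha_odd_def)
    ultimately show ?case using orbit.step[of n "alpha_odd n" "n + 1"] by simp
  next
    case (Suc k)
    have "alpha_odd n (n + 2 + k) = n - Suc k" using Suc.prems by (auto simp: alpha_odd_def)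
    then have "n - Suc k \<in> ?O"
      using Suc orbit.step[of "n + 2 + k" "alpha_odd n" "n + 1"] by simp
    moreover have "alpha_odd n (n - Suc k) = n + 2 + Suc k"
      using Suc.prems by (auto simp: alpha_odd_def)
    ultimately show ?case using orbit.step[of "n - Suc k" "alpha_odd n" "n + 1"] by simp
  qed
  have "2 * n + 1 \<in> ?O" using steps[of "n - 1"] n by (simp add: mult_2)
  moreover have "alpha_odd n (2 * n + 1) = n + 1" by (simp add: alpha_odd_def)
  ultimately have mid: "n + 1 \<in> ?O"
    using orbit.step[of "2 * n + 1" "alpha_odd n" "n + 1"] by simp
  have "x \<in> ?O" if "x \<in> {1..2 * n + 1}" for x
  proof -
    consider "x \<le> n" | "x = n + 1" | "x \<ge> n + 2" by linarith
    then show ?thesis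
    proof cases
      case 1
      then show ?thesis using steps[of "n - x"] that by simp
    next
      case 2
      then show ?thesis using mid by simp
    next
      case 3
      obtain k where "x = n + 2 + k" using le_Suc_ex[OF 3] by blast
      then show ?thesis using steps[of k] that by simp
    qed
  qed
  moreover have "x \<in> {1..2 * n + 1}" if "x \<in> ?O" for x
    using that by induction (auto simp: alpha_odd_def)
  ultimately have "{1..2 * n + 1} = ?O" by blast
  with mid show ?thesis by (metis cyclic_on_singleI)
qed

text \<open>The reversal \<open>i \<mapsto> 2n+2-i\<close> of \<open>{1..2n+1}\<close> conjugates \<open>alpha_odd n\<close> to \<open>beta_odd n\<close>.\<close>

lemma cyclic_on_beta_odd:
  assumes n: "n \<ge> 1"
  shows "cyclic_on (beta_odd n) {1..2 * n + 1}"
proof -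
  let ?r = "\<lambda>i. 2 * n + 2 - i"
  have "cyclic_on (beta_odd n) (?r ` {1..2 * n + 1})"
    by (rule cyclic_on_image[OF cyclic_on_alpha_odd[OF n]])
      (auto simp: alpha_odd_def beta_odd_def)
  moreover have "?r ` {1..2 * n + 1} = {1..2 * n + 1}"
  proof
    show "{1..2 * n + 1} \<subseteq> ?r ` {1..2 * n + 1}"
    proof
      fix x assume x: "x \<in> {1..2 * n + 1}"
      then have "x = ?r (?r x)" "?r x \<in> {1..2 * n + 1}" by auto
      then show "x \<in> ?r ` {1..2 * n + 1}" by blast
    qed
  qed auto
  ultimately show ?thesis by (simp only:)
qed

lemma cyclic_on_simple_odd:
  assumes "n \<ge> 1" "simple_odd n \<sigma>"
  shows "cyclic_on \<sigma> {1..2 * n + 1}"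
  using assms cyclic_on_alpha_odd[of n] cyclic_on_beta_odd[of n] unfolding simple_odd_def by blast

section \<open>Simple permutations of mixed order with a given square\<close>

lemma right_pasting_simps:
  "1 \<le> i \<Longrightarrow> i \<le> m \<Longrightarrow> right_pasting m k \<sigma> \<tau> i = \<sigma> i"
  "1 \<le> i \<Longrightarrow> i \<le> k \<Longrightarrow> right_pasting m k \<sigma> \<tau> (m + i) = \<tau> i + m"
  by (auto simp: right_pasting_def add.commute)

lemma block_simps: "block n 1 = {1..2 * n + 1}" "block n 2 = {2 * n + 2..4 * n + 2}"
  by (simp_all add: block_def)

lemma block_2_eq_shift: "block n 2 = (+) (2 * n + 1) ` {1..2 * n + 1}"
proof -
  have "(+) (2 * n + 1) ` {1..2 * n + 1} = {2 * n + 1 + 1..2 * n + 1 + (2 * n + 1)}"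
    by (simp only: image_add_atLeastAtMost add.commute)
  then show ?thesis by (simp add: block_simps)
qed

text \<open>
  Besides exchanging the blocks, a simple permutation of mixed order only has to satisfy a condition
  on its square, and the two halves of the Pasting fulfil that condition.
\<close>

lemma simple_mixed_with_square_eq_exchanging_roots:
  assumes \<sigma>: "simple_odd n \<sigma>" and \<tau>: "simple_odd n \<tau>"
  defines "\<pi> \<equiv> right_pasting (2 * n + 1) (2 * n + 1) \<sigma> \<tau>"
  shows "{\<theta>. simple_mixed n \<theta> \<and> \<theta> ^^ 2 = \<pi>} = exchanging_roots \<pi> (block n 1) (block n 2)"
proof -
  let ?M = "2 * n + 1"
  \<comment> \<open>The order-preserving identifications of \<open>{1..2n+1}\<close> with the blocks are the identity and the
    shift by \<open>2n+1\<close>; through them the square restricts to \<open>\<sigma>\<close> and \<open>\<tau>\<close>.\<close>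
  have restr: "\<exists>h \<rho>. bij_betw h {1..?M} (block n j) \<and> strict_mono_on {1..?M} h \<and>
      simple_odd n \<rho> \<and> (\<forall>i\<in>{1..?M}. \<pi> (h i) = h (\<rho> i))" if j: "j \<in> {1, 2}" for j
  proof (cases "j = 1")
    case True
    have "bij_betw id {1..?M} (block n j) \<and> strict_mono_on {1..?M} id \<and>
      simple_odd n \<sigma> \<and> (\<forall>i\<in>{1..?M}. \<pi> (id i) = id (\<sigma> i))"
      using \<sigma> True by (auto simp: block_def \<pi>_def right_pasting_simps strict_mono_on_def)
    then show ?thesis by blast
  next
    case False
    have "bij_betw ((+) ?M) {1..?M} (block n j)"
      using False j block_2_eq_shift by (auto simp: bij_betw_def)
    moreover have "\<forall>i\<in>{1..?M}. \<pi> (?M + i) = ?M + \<tau> i"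
      unfolding \<pi>_def using right_pasting_simps(2)[of _ ?M ?M \<sigma> \<tau>] by (simp add: add.commute)
    moreover have "strict_mono_on {1..?M} ((+) ?M)" by (auto simp: strict_mono_on_def)
    ultimately show ?thesis using \<tau> by blast
  qed
  have un: "block n 1 \<union> block n 2 = {1..4 * n + 2}" by (auto simp: block_def)
  have swap: "transpose (1::nat) 2 1 = 2" "transpose (1::nat) 2 2 = 1" by simp_all
  have "simple_mixed n \<theta> \<and> \<theta> ^^ 2 = \<pi> \<longleftrightarrow> \<theta> \<in> exchanging_roots \<pi> (block n 1) (block n 2)" for \<theta>
  proof -
    have sq: "\<theta> ^^ 2 = \<theta> \<circ> \<theta>" by (simp add: numeral_2_eq_2)
    show ?thesis
    proof
      assume "simple_mixed n \<theta> \<and> \<theta> ^^ 2 = \<pi>"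
      then show "\<theta> \<in> exchanging_roots \<pi> (block n 1) (block n 2)"
        unfolding simple_mixed_def exchanging_roots_def un sq using swap by simp
    next
      assume "\<theta> \<in> exchanging_roots \<pi> (block n 1) (block n 2)"
      then have "\<theta> permutes {1..4 * n + 2}" "\<theta> ` block n 1 = block n 2"
        "\<theta> ` block n 2 = block n 1" "\<theta> ^^ 2 = \<pi>"
        unfolding exchanging_roots_def un sq by auto
      then show "simple_mixed n \<theta> \<and> \<theta> ^^ 2 = \<pi>"
        unfolding simple_mixed_def using restr swap by simp
    qed
  qed
  then show ?thesis by blast
qed

lemma card_simple_mixed_with_square:
  assumes n: "n \<ge> 1" and \<sigma>: "simple_odd n \<sigma>" and \<tau>: "simple_odd n \<tau>"
  defines "\<pi> \<equiv> right_pasting (2 * n + 1) (2 * n + 1) \<sigma> \<tau>"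
  shows "card {\<theta>. simple_mixed n \<theta> \<and> \<theta> ^^ 2 = \<pi>} = 2 * n + 1"
proof -
  let ?M = "2 * n + 1"
  have "cyclic_on \<pi> (id ` {1..?M})"
    using cyclic_on_simple_odd[OF n \<sigma>]
    by (rule cyclic_on_image) (simp add: \<pi>_def right_pasting_simps)
  then have 1: "cyclic_on \<pi> (block n 1)" by (simp only: block_simps image_id id_apply)
  have "cyclic_on \<pi> ((+) ?M ` {1..?M})"
    using cyclic_on_simple_odd[OF n \<tau>]
  proof (rule cyclic_on_image)
    fix i assume "i \<in> {1..?M}"
    then show "\<pi> (?M + i) = ?M + \<tau> i"
      unfolding \<pi>_def using right_pasting_simps(2)[of i ?M ?M \<sigma> \<tau>] by (simp add: add.commute)
  qed
  then have 2: "cyclic_on \<pi> (block n 2)" by (simp only: block_2_eq_shift)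
  have "card (exchanging_roots \<pi> (block n 1) (block n 2)) = card (block n 1)"
    using 1 2 by (rule card_exchanging_roots) (auto simp: block_def \<pi>_def right_pasting_def)
  then show ?thesis
    using simple_mixed_with_square_eq_exchanging_roots[OF \<sigma> \<tau>] by (simp add: \<pi>_def block_def)
qed

lemma alpha_odd_1_neq_beta_odd_1: "n \<ge> 1 \<Longrightarrow> alpha_odd n 1 \<noteq> beta_odd n 1"
  by (simp add: alpha_odd_def beta_odd_def)

text \<open>
  The values at \<open>1\<close> and \<open>2n+2\<close>, the first elements of the blocks, tell the four Pastings apart,
  because \<open>alpha_odd n 1 = 2n+1\<close> differs from \<open>beta_odd n 1 = n+1\<close>.
\<close>

lemma right_pasting_simple_odd_inj:
  assumes n: "n \<ge> 1"
    and simple: "simple_odd n \<sigma>" "simple_odd n \<tau>" "simple_odd n \<sigma>'" "simple_odd n \<tau>'"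
    and eq: "right_pasting (2 * n + 1) (2 * n + 1) \<sigma> \<tau> =
             right_pasting (2 * n + 1) (2 * n + 1) \<sigma>' \<tau>'"
  shows "\<sigma> = \<sigma>' \<and> \<tau> = \<tau>'"
proof -
  \<comment> \<open>\<open>2n+2\<close> appears as \<open>(2n+1) + 1\<close>, the shifted position of \<open>1\<close> in the second block.\<close>
  have "\<sigma> 1 = \<sigma>' 1" "\<tau> 1 = \<tau>' 1"
    using fun_cong[OF eq, of 1] fun_cong[OF eq, of "2 * n + 1 + 1"]
    by (simp_all add: right_pasting_def)
  then show ?thesis using simple alpha_odd_1_neq_beta_odd_1[OF n] by (auto simp: simple_odd_def)
qed

theorem theorem3p1:
  fixes n :: nat
  assumes "n \<ge> 1"
  shows "card {\<theta>. simple_mixed n \<theta> \<and>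
           \<theta> ^^ 2 \<in>
             {right_pasting (2 * n + 1) (2 * n + 1) (alpha_odd n) (alpha_odd n),
              right_pasting (2 * n + 1) (2 * n + 1) (beta_odd n) (beta_odd n),
              right_pasting (2 * n + 1) (2 * n + 1) (alpha_odd n) (beta_odd n),
              right_pasting (2 * n + 1) (2 * n + 1) (beta_odd n) (alpha_odd n)}} = 8 * n + 4"
    (is "card {\<theta>. _ \<and> _ \<in> ?S} = _")
proof -
  let ?\<Theta> = "\<lambda>\<pi>. {\<theta>. simple_mixed n \<theta> \<and> \<theta> ^^ 2 = \<pi>}"
  let ?p = "\<lambda>(\<sigma>, \<tau>). right_pasting (2 * n + 1) (2 * n + 1) \<sigma> \<tau>"
  let ?I = "{alpha_odd n, beta_odd n} \<times> {alpha_odd n, beta_odd n}"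
  define S where "S = ?p ` ?I"
  have S_eq: "?S = S" by (auto simp: S_def)
  have inj: "inj_on ?p ?I"
  proof (rule inj_onI, clarify)
    fix \<sigma> \<tau> \<sigma>' \<tau>'
    assume "\<sigma> \<in> {alpha_odd n, beta_odd n}" "\<tau> \<in> {alpha_odd n, beta_odd n}"
      "\<sigma>' \<in> {alpha_odd n, beta_odd n}" "\<tau>' \<in> {alpha_odd n, beta_odd n}"
      and eq: "right_pasting (2 * n + 1) (2 * n + 1) \<sigma> \<tau> =
        right_pasting (2 * n + 1) (2 * n + 1) \<sigma>' \<tau>'"
    then have "simple_odd n \<sigma>" "simple_odd n \<tau>" "simple_odd n \<sigma>'" "simple_odd n \<tau>'"
      by (auto simp: simple_odd_def)
    then show "\<sigma> = \<sigma>' \<and> \<tau> = \<tau>'" using right_pasting_simple_odd_inj[OF assms] eq by blast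
  qed
  have "card {alpha_odd n, beta_odd n} = 2"
    using alpha_odd_1_neq_beta_odd_1[OF assms] by (metis card_2_iff)
  then have card_S: "card S = 4"
    unfolding S_def card_image[OF inj] card_cartesian_product by simp
  have card_\<Theta>: "card (?\<Theta> \<pi>) = 2 * n + 1" if "\<pi> \<in> S" for \<pi>
  proof -
    obtain \<sigma> \<tau> where "\<pi> = right_pasting (2 * n + 1) (2 * n + 1) \<sigma> \<tau>"
      "simple_odd n \<sigma>" "simple_odd n \<tau>"
      using \<open>\<pi> \<in> S\<close> unfolding S_def simple_odd_def by fastforce
    then show ?thesis using card_simple_mixed_with_square[OF assms] by simp
  qed
  have fin: "finite (?\<Theta> \<pi>)" if "\<pi> \<in> S" for \<pi>
    using card_\<Theta>[OF that] by (intro card_ge_0_finite) simp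
  have "{\<theta>. simple_mixed n \<theta> \<and> \<theta> ^^ 2 \<in> S} = (\<Union>\<pi>\<in>S. ?\<Theta> \<pi>)" by blast
  also have "card \<dots> = (\<Sum>\<pi>\<in>S. card (?\<Theta> \<pi>))"
  proof (rule card_UN_disjoint)
    show "finite S" using card_S by (intro card_ge_0_finite) simp
    show "\<forall>\<pi>\<in>S. finite (?\<Theta> \<pi>)" using fin by blast
    show "\<forall>\<pi>\<in>S. \<forall>\<pi>'\<in>S. \<pi> \<noteq> \<pi>' \<longrightarrow> ?\<Theta> \<pi> \<inter> ?\<Theta> \<pi>' = {}" by blast
  qed
  also have "\<dots> = card S * (2 * n + 1)" by (simp add: card_\<Theta>)
  finally show ?thesis unfolding S_eq card_S by simp
qed

end
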